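(* Let $n\in\mathbb{N}$, let $f\colon\mathbb{R}^n\to\mathbb{R}^n$ satisfy $f(0_n)=0_n$, let $\mathcal{X}\subseteq\mathbb{R}^n$ satisfy $0_n\in\mathrm{int}(\mathcal{X})$, and assume $0_n\in\mathrm{int}(\mathcal{D}_0^{\mathcal{X}})$. Let $\mathcal{V}\subseteq\mathcal{X}$ be a safe region of attraction within $\mathcal{X}$. Assume that $\mathcal{X}=\{x\in\mathbb{R}^n\mid\theta(x)\le 1\}$ and $\mathcal{V}=\{x\in\mathbb{R}^n\mid v(x)\le 1\}$ for given functions $\theta,v\colon\mathbb{R}^n\to\mathbb{R}$. Define the sequence of sets $\{\mathcal{V}_k\}_{k\in\mathbb{Z}_+}$ by $\mathcal{V}_0=\mathcal{V}$ and $\mathcal{V}_{k+1}=f^{-1}(\mathcal{V}_k)\cap\mathcal{X}$ for $k\in\mathbb{Z}_+$. Define functions $v_k\colon\mathbb{R}^n\to\mathbb{R}$, $k\in\mathbb{Z}_+$, by $v_0=v$ and $$v_{k+1}(x)=\max\{\theta(x),\,v_k(f(x))\},\qquad x\in\mathbb{R}^n,\ k\in\mathbb{Z}_+.$$ Then $$\mathcal{V}_k=\{x\in\mathbb{R}^n\mid v_k(x)\le 1\}\quad\text{for all } k\in\mathbb{Z}_+,$$ and the functions $v_k$ are given explicitly by $$v_{k+1}(x)=\max\Big\{\max_{i\in\{0,1,\dots,k\}}\theta(\varphi_x(i)),\ v(\varphi_x(k+1))\Big\}\quad\text{for all } x\in\mathbb{R}^n,\ k\in\mathbb{Z}_+.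$$
   Context: $\mathbb{Z}_+$ denotes the non-negative integers, $0_n$ the zero vector of $\mathbb{R}^n$, $\mathrm{int}$ the topological interior in $\mathbb{R}^n$, and $f^{-1}(Q)=\{x\in\mathbb{R}^n \mid f(x)\in Q\}$ the preimage ($f$ need not be invertible or continuous). Consider the discrete-time system $x_{k+1}=f(x_k)$, $k\in\mathbb{Z}_+$. The trajectory starting from $x\in\mathbb{R}^n$ is $\varphi_x\colon\mathbb{Z}_+\to\mathbb{R}^n$, $\varphi_x(0)=x$, $\varphi_x(k+1)=f(\varphi_x(k))=f^{k+1}(x)$. The safe domain of attraction within $\mathcal{X}$ is $$\mathcal{D}_0^{\mathcal{X}}=\{x\in\mathbb{R}^n \mid \varphi_x(k)\in\mathcal{X}\ \forall k\in\mathbb{Z}_+,\ \lim_{k\to\infty}\varphi_x(k)=0_n\}.$$ A subset $\mathcal{S}\subseteq\mathbb{R}^n$ is called a safe region of attraction within $\mathcal{X}$ iff $\mathcal{S}\subseteq\mathcal{D}_0^{\mathcal{X}}$, $0_n\in\mathrm{int}(\mathcal{S})$, and $f(\mathcal{S})\subseteq\mathcal{S}$. *)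

theory Defs
  imports "HOL-Analysis.Analysis"
begin

primrec traj :: "(real^'n \<Rightarrow> real^'n) \<Rightarrow> real^'n \<Rightarrow> nat \<Rightarrow> real^'n" where
  "traj f x 0 = x"
| "traj f x (Suc k) = f (traj f x k)"

definition safe_doa :: "(real^'n \<Rightarrow> real^'n) \<Rightarrow> (real^'n) set \<Rightarrow> (real^'n) set" where
  "safe_doa f X = {x. (\<forall>k. traj f x k \<in> X) \<and> traj f x \<longlonglongrightarrow> 0}"

definition safe_roa :: "(real^'n \<Rightarrow> real^'n) \<Rightarrow> (real^'n) set \<Rightarrow> (real^'n) set \<Rightarrow> bool" where
  "safe_roa f X S \<longleftrightarrow> S \<subseteq> safe_doa f X \<and> 0 \<in> interior S \<and> f ` S \<subseteq> S"

primrec roa_seq ::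
  "(real^'n \<Rightarrow> real^'n) \<Rightarrow> (real^'n) set \<Rightarrow> (real^'n) set \<Rightarrow> nat \<Rightarrow> (real^'n) set" where
  "roa_seq f X V 0 = V"
| "roa_seq f X V (Suc k) = (f -` roa_seq f X V k) \<inter> X"

primrec roa_fun ::
  "(real^'n \<Rightarrow> real^'n) \<Rightarrow> (real^'n \<Rightarrow> real) \<Rightarrow> (real^'n \<Rightarrow> real) \<Rightarrow> nat \<Rightarrow> real^'n \<Rightarrow> real" where
  "roa_fun f \<theta> v 0 = v"
| "roa_fun f \<theta> v (Suc k) = (\<lambda>x. max (\<theta> x) (roa_fun f \<theta> v k (f x)))"

end

theory Submission
  imports Defs
begin

text \<open>
  Both claims are inductions on \<open>k\<close> that peel off the \<^emph>\<open>first\<close> step of the trajectory. A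
  maximum is at most \<open>1\<close> exactly when both arguments are, so taking the maximum with
  \<open>\<theta>\<close> mirrors intersecting with \<open>X\<close>, and composing with \<open>f\<close> mirrors taking the
  preimage: the recursions for the sets and for the functions correspond line by line
  (\<open>roa_seq_sublevel\<close>). For the explicit formula the induction hypothesis is applied at
  \<open>f x\<close>, whose trajectory is that of \<open>x\<close> advanced by one step (\<open>traj_shift\<close>); the
  remaining term \<open>\<theta> x\<close> supplies the index \<open>0\<close> of the maximum (\<open>roa_fun_explicit\<close>).
\<close>

text \<open>
  The trajectory is defined by appending a step at its end, whereas the sets and functions
  recurse through the initial point; this identity mediates between the two.
\<close>

lemma traj_shift: "traj f (f x) k = traj f x (Suc k)"
  by (induction k) simp_all

lemma roa_seq_sublevel:
  "roa_seq f {x. \<theta> x \<le> 1} {x. v x \<le> 1} k = {x. roa_fun f \<theta> v k x \<le> 1}"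
  by (induction k) auto

lemma roa_fun_explicit:
  "roa_fun f \<theta> v (Suc k) x =
     max (Max ((\<lambda>i. \<theta> (traj f x i)) ` {0..k})) (v (traj f x (Suc k)))"
proof (induction k arbitrary: x)
  case 0
  show ?case by simp
next
  case (Suc k)
  let ?M = "Max ((\<lambda>i. \<theta> (traj f x (Suc i))) ` {0..k})"
  have "(\<lambda>i. \<theta> (traj f x i)) ` {0..Suc k} =
      insert (\<theta> x) ((\<lambda>i. \<theta> (traj f x (Suc i))) ` {0..k})"
    by (simp only: atLeast0_atMost_Suc_eq_insert_0 image_insert image_image traj.simps(1))
  then have split: "Max ((\<lambda>i. \<theta> (traj f x i)) ` {0..Suc k}) = max (\<theta> x) ?M"
    by (simp only:) (rule Max_insert, auto)
  have "roa_fun f \<theta> v (Suc (Suc k)) x = max (\<theta> x) (roa_fun f \<theta> v (Suc k) (f x))"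
    by (simp only: roa_fun.simps)
  also have "\<dots> = max (\<theta> x) (max ?M (v (traj f x (Suc (Suc k)))))"
    by (simp only: Suc.IH traj_shift)
  also have "\<dots> = max (max (\<theta> x) ?M) (v (traj f x (Suc (Suc k))))"
    by (simp only: max.assoc)
  finally show ?case
    by (simp only: split)
qed

theorem theorem6:
  fixes f :: "real^'n \<Rightarrow> real^'n"
    and X V :: "(real^'n) set"
    and \<theta> v :: "real^'n \<Rightarrow> real"
  assumes "f 0 = 0"
    and "0 \<in> interior X"
    and "0 \<in> interior (safe_doa f X)"
    and "V \<subseteq> X"
    and "safe_roa f X V"
    and "X = {x. \<theta> x \<le> 1}"
    and "V = {x. v x \<le> 1}"
  shows "(\<forall>k. roa_seq f X V k = {x. roa_fun f \<theta> v k x \<le> 1}) \<and>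
    (\<forall>x k. roa_fun f \<theta> v (k + 1) x =
       max (Max ((\<lambda>i. \<theta> (traj f x i)) ` {0..k})) (v (traj f x (k + 1))))"
  using roa_seq_sublevel[of f \<theta> v] roa_fun_explicit[of f \<theta> v]
  unfolding assms(6,7) Suc_eq_plus1 by blast

end
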